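(* Let $p$ be a prime and let $r$ be a positive integer. Then \[P_{\mathbb{Z}_{p^{r}}\times\mathbb{Z}_{p^{r}}}=\frac{(r+1)^2(p-1)^2}{p^{r+1}(p+1)-2r(p-1)-3p+1}\] and \[P_{\mathbb{Z}_p\times\mathbb{Z}_p}=\frac{4}{p+3}.\]
   Context: $\mathbb{Z}_N$ is the ring of integers modulo $N$; product rings have componentwise operations. For a finite commutative ring $R$, $P_R$ denotes the probability that a randomly chosen subgroup of $(R,+)$ is an ideal of $R$, i.e. $P_R$ is the total number of ideals of $R$ divided by the total number of subgroups of $(R,+)$. *)

theory Defs
  imports Complex_Main "HOL-Algebra.Chinese_Remainder" "HOL-Number_Theory.Residues"
begin

text \<open>
  The probability that a uniformly random subgroup of the additive group of \<open>R\<close> is an ideal.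
  Every ideal is an additive subgroup, so this is a quotient of two cardinalities. It is only
  meaningful when both sets are finite, in particular for a finite commutative ring \<open>R\<close>.
\<close>

definition ideal_probability :: "('a, 'm) ring_scheme \<Rightarrow> real" where
  "ideal_probability R =
     real (card {I. ideal I R}) / real (card {H. subgroup H (add_monoid R)})"

end

theory Submission
  imports Defs "HOL-Library.Product_Plus"
begin

text \<open>
  Both cardinalities are found for \<open>\<int>\<^sub>n \<times> \<int>\<^sub>n\<close> with an arbitrary modulus \<open>n > 1\<close>, from one
  parametrisation of its additive subgroups.

  A subgroup of \<open>\<int>\<^sub>n \<times> \<int>\<^sub>n\<close> is the reduction modulo \<open>n\<close> of a unique subgroup of \<open>\<int> \<times> \<int>\<close> that
  contains \<open>n\<int> \<times> n\<int>\<close>, and such a lattice has a Hermite normal form: it is generated by \<open>(d, t)\<close>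
  and \<open>(0, e)\<close>, where \<open>d\<close> generates its projection to the first coordinate, \<open>e\<close> generates its
  intersection with the second axis, and \<open>t\<close> is determined modulo \<open>e\<close>, so that one can take
  \<open>0 \<le> t < e\<close>. Here \<open>d\<close> and \<open>e\<close> divide \<open>n\<close>, and the only other constraint is that \<open>(n, 0)\<close> lies in
  the lattice, i.e. that \<open>e\<close> divides \<open>(n / d) t\<close>. For given \<open>d\<close> and \<open>e\<close> this leaves \<open>gcd (n / d) e\<close>
  values of \<open>t\<close>; as \<open>n / d\<close> runs through the divisors of \<open>n\<close> together with \<open>d\<close>, the number of
  subgroups is the sum of \<open>gcd d e\<close> over all pairs of divisors
  (\<open>card_subgroups_residue_square\<close>).

  In the same coordinates the ideals are the lattices with \<open>t = 0\<close>: multiplication by the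
  idempotent \<open>(1, 0)\<close> brings \<open>(d, 0)\<close>, hence \<open>(0, t)\<close>, into an ideal, which forces \<open>e\<close> to divide \<open>t\<close>.
  So there are as many ideals as pairs of divisors (\<open>card_ideals_residue_square\<close>).

  For \<open>n = p\<^sup>r\<close> the divisors are \<open>p\<^sup>0, \<dots>, p\<^sup>r\<close>, and the gcd of two powers of \<open>p\<close> is the one with
  the smaller exponent. The remaining double sum is evaluated in \<open>sum_power_min\<close>.
\<close>

section \<open>Lattices in the integer plane that contain a multiple of it\<close>

text \<open>
  The least positive element generates: the remainder of any element on division by it is again
  an element, and a smaller one. This supplies both diagonal entries of the Hermite normal form.
\<close>
lemma int_diff_closed_eq_multiples:
  fixes A :: "int set" and n :: int
  assumes diff: "\<And>x y. x \<in> A \<Longrightarrow> y \<in> A \<Longrightarrow> x - y \<in> A" and "n \<in> A" and "n > 0"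
  shows "\<exists>d>0. d dvd n \<and> A = {x. d dvd x}"
proof -
  have zero: "0 \<in> A" using diff[OF \<open>n \<in> A\<close> \<open>n \<in> A\<close>] by simp
  have mult: "k * x \<in> A" if "x \<in> A" for k x :: int
  proof (induction k rule: int_induct[where k = 0])
    case base
    show ?case using zero by simp
  next
    case (step1 i)
    show ?case
      using diff[OF step1.IH diff[OF zero that]] by (simp add: algebra_simps)
  next
    case (step2 i)
    show ?case using diff[OF step2.IH that] by (simp add: algebra_simps)
  qed
  define m where "m = (LEAST m::nat. m > 0 \<and> int m \<in> A)"
  have "m > 0 \<and> int m \<in> A"
    unfolding m_def by (rule LeastI[of _ "nat n"]) (use assms in auto)
  then have m: "m > 0" "int m \<in> A" by auto
  have "int m dvd x" if "x \<in> A" for x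
  proof -
    have "x - x div int m * int m \<in> A" by (intro diff that mult m)
    then have "x mod int m \<in> A" by (simp add: minus_div_mult_eq_mod)
    moreover have "x mod int m \<ge> 0" "x mod int m < int m" using m by simp_all
    ultimately have "x mod int m = 0"
      using not_less_Least[of "nat (x mod int m)" "\<lambda>m. m > 0 \<and> int m \<in> A"]
      unfolding m_def[symmetric] by fastforce
    then show ?thesis by auto
  qed
  moreover have "x \<in> A" if "int m dvd x" for x
    using that mult[OF m(2)] by (auto elim!: dvdE simp: mult.commute)
  ultimately have "A = {x. int m dvd x}" by blast
  then show ?thesis using m \<open>n \<in> A\<close> by (intro exI[of _ "int m"]) auto
qed

definition diff_closed :: "(int \<times> int) set \<Rightarrow> bool" where
  "diff_closed L \<longleftrightarrow> (\<forall>u\<in>L. \<forall>v\<in>L. u - v \<in> L)"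

text \<open>
  The lattice generated by the rows \<open>(d, t)\<close> and \<open>(0, e)\<close> of an upper triangular matrix.
\<close>
definition lattice_basis :: "int \<Rightarrow> int \<Rightarrow> int \<Rightarrow> (int \<times> int) set" where
  "lattice_basis d e t = {(d * k, t * k + e * l) |k l. True}"

definition pos_divisors :: "int \<Rightarrow> int set" where
  "pos_divisors n = {d. 0 < d \<and> d dvd n}"

text \<open>
  The off-diagonal entries \<open>t\<close> that are reduced modulo \<open>e\<close> and for which the lattice contains
  \<open>(n, 0)\<close>: for \<open>d\<close> dividing \<open>n\<close>, subtracting \<open>n / d\<close> copies of \<open>(d, t)\<close> from \<open>(n, 0)\<close> leaves
  \<open>(0, - (n / d) t)\<close>, which must be a multiple of \<open>(0, e)\<close>.
\<close>
definition shifts :: "int \<Rightarrow> int \<Rightarrow> int \<Rightarrow> int set" where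
  "shifts n d e = {t. 0 \<le> t \<and> t < e \<and> e dvd n div d * t}"

lemma diff_closed_lattice_basis: "diff_closed (lattice_basis d e t)"
proof -
  have "\<exists>k'' l''. d * k - d * k' = d * k'' \<and> t * k + e * l - (t * k' + e * l') = t * k'' + e * l''"
    for k l k' l' :: int
    by (intro exI[of _ "k - k'"] exI[of _ "l - l'"]) (simp add: algebra_simps)
  then show ?thesis by (auto simp: diff_closed_def lattice_basis_def)
qed

lemma multiples_in_lattice_basis:
  assumes "d \<in> pos_divisors n" "e \<in> pos_divisors n" "t \<in> shifts n d e"
  shows "(n, 0) \<in> lattice_basis d e t" "(0, n) \<in> lattice_basis d e t"
proof -
  obtain c where c: "n div d * t = e * c" using assms(3) by (auto simp: shifts_def elim: dvdE)
  have "n = d * (n div d)" using assms(1) by (simp add: pos_divisors_def)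
  moreover have "0 = t * (n div d) + e * (- c)" using c by (simp add: mult.commute)
  ultimately show "(n, 0) \<in> lattice_basis d e t" unfolding lattice_basis_def by blast
  obtain b where "n = e * b" using assms(2) by (auto simp: pos_divisors_def elim: dvdE)
  then have "0 = d * 0" "n = t * 0 + e * b" by auto
  then show "(0, n) \<in> lattice_basis d e t" unfolding lattice_basis_def by blast
qed

text \<open>
  The Hermite normal form. The entry \<open>d\<close> comes from the projection of \<open>L\<close> to the first
  coordinate and \<open>e\<close> from the fibre over \<open>0\<close>. Any lift of \<open>d\<close> to \<open>L\<close> can be moved along the fibre
  until its second coordinate is reduced modulo \<open>e\<close>; after subtracting a multiple of this lift,
  every element of \<open>L\<close> falls into the fibre.
\<close>
lemma lattice_normal_form:
  assumes "diff_closed L" "(n, 0) \<in> L" "(0, n) \<in> L" "n > 0"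
  obtains d e t where "d \<in> pos_divisors n" "e \<in> pos_divisors n" "t \<in> shifts n d e"
    "L = lattice_basis d e t"
proof -
  have diff: "(x - x', y - y') \<in> L" if "(x, y) \<in> L" "(x', y') \<in> L" for x y x' y'
    using assms(1) that by (force simp: diff_closed_def)
  have add: "(x + x', y + y') \<in> L" if "(x, y) \<in> L" "(x', y') \<in> L" for x y x' y'
    using diff[OF that(1) diff[OF diff[OF that(2) that(2)] that(2)]] by simp
  have mult: "(k * x, k * y) \<in> L" if "(x, y) \<in> L" for k x y
  proof (induction k rule: int_induct[where k = 0])
    case base
    show ?case using diff[OF that that] by simp
  next
    case (step1 i)
    show ?case using add[OF step1.IH that] by (simp add: algebra_simps)
  next
    case (step2 i)
    show ?case using diff[OF step2.IH that] by (simp add: algebra_simps)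
  qed
  have "\<exists>d>0. d dvd n \<and> fst ` L = {x. d dvd x}"
  proof (rule int_diff_closed_eq_multiples)
    fix x y assume "x \<in> fst ` L" "y \<in> fst ` L"
    then show "x - y \<in> fst ` L" using diff by force
  qed (use assms in force)+
  then obtain d where d: "d > 0" "d dvd n" "fst ` L = {x. d dvd x}" by blast
  have "\<exists>e>0. e dvd n \<and> {y. (0, y) \<in> L} = {y. e dvd y}"
  proof (rule int_diff_closed_eq_multiples)
    fix x y assume "x \<in> {y. (0, y) \<in> L}" "y \<in> {y. (0, y) \<in> L}"
    then show "x - y \<in> {y. (0, y) \<in> L}" using diff[of 0 x 0 y] by simp
  qed (use assms in auto)
  then obtain e where e: "e > 0" "e dvd n" "{y. (0, y) \<in> L} = {y. e dvd y}" by blast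
  have fibre: "(0, y) \<in> L \<longleftrightarrow> e dvd y" for y using e(3) by blast
  have "d \<in> fst ` L" using d by simp
  then obtain t0 where t0: "(d, t0) \<in> L" by force
  define t where "t = t0 mod e"
  have t_bounds: "0 \<le> t" "t < e" using e by (auto simp: t_def)
  have "(0, t0 - t) \<in> L" unfolding fibre t_def by (simp add: minus_mod_eq_mult_div)
  from diff[OF t0 this] have t: "(d, t) \<in> L" by simp
  have "L = lattice_basis d e t"
  proof (intro Set.set_eqI iffI)
    fix u assume "u \<in> L"
    then obtain x y where u: "u = (x, y)" "(x, y) \<in> L" by (cases u) auto
    then have "x \<in> fst ` L" by force
    then obtain k where k: "x = d * k" using d by (auto elim: dvdE)
    have "(0, y - k * t) \<in> L" using diff[OF u(2) mult[OF t, of k]] k by (simp add: mult.commute)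
    then obtain l where "y - k * t = e * l" unfolding fibre by (auto elim: dvdE)
    then have "y = t * k + e * l" by (simp add: algebra_simps)
    then show "u \<in> lattice_basis d e t" unfolding lattice_basis_def u k by blast
  next
    fix u assume "u \<in> lattice_basis d e t"
    then obtain k l where u: "u = (d * k, t * k + e * l)" by (auto simp: lattice_basis_def)
    have "(0, e * l) \<in> L" unfolding fibre by simp
    from add[OF mult[OF t, of k] this] show "u \<in> L" unfolding u by (simp add: mult.commute)
  qed
  moreover have "e dvd n div d * t"
    using diff[OF mult[OF t, of "n div d"] assms(2)] d(2) fibre[of "n div d * t"] by simp
  ultimately show thesis
    using that d e t_bounds by (auto simp: pos_divisors_def shifts_def)
qed

text \<open>
  The diagonal entries are recovered from the projection and the fibre, which depend on the
  lattice only; two choices of \<open>t\<close> differ by an element of the fibre, i.e. by a multiple of \<open>e\<close>.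
\<close>
lemma lattice_basis_inject:
  assumes eq: "lattice_basis d e t = lattice_basis d' e' t'"
    and "d > 0" "d' > 0" "e > 0" "e' > 0" "0 \<le> t" "t < e" "0 \<le> t'" "t' < e'"
  shows "d = d' \<and> e = e' \<and> t = t'"
proof -
  have proj: "fst ` lattice_basis d e t = {x. d dvd x}" for d e t
  proof (intro Set.set_eqI iffI)
    fix x assume "x \<in> {x. d dvd x}"
    then obtain k where "x = d * k" by (auto elim: dvdE)
    moreover have "(d * k, t * k + e * 0) \<in> lattice_basis d e t"
      unfolding lattice_basis_def by blast
    ultimately show "x \<in> fst ` lattice_basis d e t" by (metis fst_conv image_eqI)
  qed (auto simp: lattice_basis_def)
  have fibre: "{y. (0, y) \<in> lattice_basis d e t} = {y. e dvd y}" if "d > 0" for d e t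
  proof (intro Set.set_eqI iffI)
    fix y assume "y \<in> {y. e dvd y}"
    then obtain l where "y = e * l" by (auto elim: dvdE)
    moreover have "(d * 0, t * 0 + e * l) \<in> lattice_basis d e t"
      unfolding lattice_basis_def by blast
    ultimately show "y \<in> {y. (0, y) \<in> lattice_basis d e t}" by simp
  qed (use that in \<open>auto simp: lattice_basis_def\<close>)
  have generator_unique: "a = b" if "{x. a dvd x} = {x. b dvd x}" "a > 0" "b > 0" for a b :: int
  proof -
    have "a dvd b" "b dvd a" using that(1) by (blast intro: dvd_refl)+
    with that(2,3) show ?thesis by (intro zdvd_antisym_nonneg) simp_all
  qed
  have d: "d = d'"
    using proj[of d e t] proj[of d' e' t'] eq assms(2,3) by (intro generator_unique) metis+
  have e: "e = e'"
    using fibre[of d e t] fibre[of d' e' t'] eq assms(2-5) by (intro generator_unique) metis+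
  have "(d * 1, t * 1 + e * 0) \<in> lattice_basis d e t" unfolding lattice_basis_def by blast
  then have "(d, t) \<in> lattice_basis d e t'" using eq d e by simp
  then obtain k l where "d = d * k" "t = t' * k + e * l" by (auto simp: lattice_basis_def)
  then have "t - t' = e * l" using \<open>d > 0\<close> by simp
  then have "t mod e = t' mod e" by (simp add: mod_eq_dvd_iff)
  then have "t = t'" using assms(6-9) e by simp
  with d e show ?thesis by simp
qed

section \<open>Subgroups and ideals of the square of a residue ring\<close>

abbreviation residue_square :: "int \<Rightarrow> (int \<times> int) ring" where
  "residue_square n \<equiv> RDirProd (residue_ring n) (residue_ring n)"

definition residue_box :: "int \<Rightarrow> (int \<times> int) set" where
  "residue_box n = {0..n - 1} \<times> {0..n - 1}"

definition reduce_mod :: "int \<Rightarrow> int \<times> int \<Rightarrow> int \<times> int" where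
  "reduce_mod n u = (fst u mod n, snd u mod n)"

lemma residue_square_ring:
  assumes "n > 1" shows "ring (residue_square n)"
proof -
  interpret residues n "residue_ring n" by unfold_locales (use assms in auto)
  show ?thesis using cring by (intro RDirProd_ring cring.axioms)
qed

lemma residue_square_simps:
  "carrier (residue_square n) = residue_box n"
  "\<zero>\<^bsub>residue_square n\<^esub> = (0, 0)"
  "u \<oplus>\<^bsub>residue_square n\<^esub> v = reduce_mod n (u + v)"
  "u \<otimes>\<^bsub>residue_square n\<^esub> v = reduce_mod n (fst u * fst v, snd u * snd v)"
  by (cases u; cases v; simp add: RDirProd_def DirProd_def monoid.defs residue_ring_def
      residue_box_def reduce_mod_def)+

lemma reduce_mod_in_box: "n > 0 \<Longrightarrow> reduce_mod n u \<in> residue_box n"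
  by (simp add: reduce_mod_def residue_box_def)

lemma reduce_mod_box: "u \<in> residue_box n \<Longrightarrow> reduce_mod n u = u"
  by (cases u) (auto simp: reduce_mod_def residue_box_def)

lemma reduce_mod_diff: "reduce_mod n (reduce_mod n u - reduce_mod n v) = reduce_mod n (u - v)"
  by (simp add: reduce_mod_def mod_diff_eq)

lemma residue_square_minus:
  assumes "n > 1" and "u \<in> residue_box n"
  shows "\<ominus>\<^bsub>residue_square n\<^esub> u = reduce_mod n (- u)"
proof -
  interpret S: ring "residue_square n" using residue_square_ring[OF assms(1)] .
  have "reduce_mod n (- u) \<oplus>\<^bsub>residue_square n\<^esub> u = \<zero>\<^bsub>residue_square n\<^esub>"
    by (simp add: residue_square_simps(2,3) reduce_mod_def mod_add_left_eq)
  then show ?thesis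
    using assms reduce_mod_in_box[of n "- u"]
    by (intro S.minus_equality) (simp_all add: residue_square_simps(1))
qed

text \<open>
  Subgroups of the residue square, described by integer subtraction followed by reduction, so
  that they can be compared with lattices.
\<close>
lemma residue_square_subgroup_iff:
  assumes "n > 1"
  shows "subgroup H (add_monoid (residue_square n)) \<longleftrightarrow>
    H \<subseteq> residue_box n \<and> H \<noteq> {} \<and> (\<forall>u\<in>H. \<forall>v\<in>H. reduce_mod n (u - v) \<in> H)"
    (is "?S \<longleftrightarrow> ?C")
proof -
  interpret S: ring "residue_square n" using residue_square_ring[OF assms] .
  have sum: "reduce_mod n (u + reduce_mod n (- v)) = reduce_mod n (u - v)" for u v
    by (simp add: reduce_mod_def mod_add_right_eq)
  show ?thesis
  proof
    assume ?S
    then interpret H: subgroup H "add_monoid (residue_square n)" .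
    have sub: "H \<subseteq> residue_box n" using H.subset by (simp add: residue_square_simps(1) del: RDirProd_add_monoid)
    have "reduce_mod n (u - v) \<in> H" if "u \<in> H" "v \<in> H" for u v
    proof -
      have "u \<oplus>\<^bsub>residue_square n\<^esub> \<ominus>\<^bsub>residue_square n\<^esub> v \<in> H"
        using H.m_closed[OF that(1) H.m_inv_closed[OF that(2)]]
        by (simp add: a_inv_def del: RDirProd_add_monoid)
      also have "\<ominus>\<^bsub>residue_square n\<^esub> v = reduce_mod n (- v)"
        using that sub assms by (intro residue_square_minus) auto
      finally show ?thesis by (simp add: residue_square_simps(3) sum)
    qed
    moreover have "H \<noteq> {}" using H.one_closed by blast
    ultimately show ?C using sub by blast
  next
    assume C: ?C
    then obtain w where "w \<in> H" by blast
    then have "reduce_mod n (w - w) \<in> H" using C by blast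
    then have zero: "0 \<in> H" by (simp add: reduce_mod_def zero_prod_def)
    have neg: "reduce_mod n (- v) \<in> H" if "v \<in> H" for v
      using C zero that by (metis diff_0)
    have add: "reduce_mod n (u + v) \<in> H" if "u \<in> H" "v \<in> H" for u v
    proof -
      have "reduce_mod n (u - reduce_mod n (- v)) \<in> H" using C that neg by blast
      then show ?thesis by (simp add: reduce_mod_def mod_diff_right_eq)
    qed
    show ?S
    proof (rule S.add.subgroupI)
      show "H \<subseteq> carrier (residue_square n)" "H \<noteq> {}"
        using C by (simp_all add: residue_square_simps(1))
      show "\<ominus>\<^bsub>residue_square n\<^esub> v \<in> H" if "v \<in> H" for v
        using that C assms neg by (subst residue_square_minus) auto
      show "u \<oplus>\<^bsub>residue_square n\<^esub> v \<in> H" if "u \<in> H" "v \<in> H" for u v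
        using add[OF that] by (simp add: residue_square_simps(3))
    qed
  qed
qed

definition lattice_residues :: "int \<Rightarrow> int \<times> int \<times> int \<Rightarrow> (int \<times> int) set" where
  "lattice_residues n = (\<lambda>(d, e, t). lattice_basis d e t \<inter> residue_box n)"

definition lattice_indices :: "int \<Rightarrow> (int \<times> int \<times> int) set" where
  "lattice_indices n = (SIGMA d:pos_divisors n. SIGMA e:pos_divisors n. shifts n d e)"

text \<open>
  An admissible lattice contains \<open>n\<int> \<times> n\<int>\<close>, so it is a union of residue classes. Hence it can be
  recovered from its points in the residue box.
\<close>
lemma lattice_basis_reduce_mod_iff:
  assumes "(d, e, t) \<in> lattice_indices n"
  shows "reduce_mod n u \<in> lattice_basis d e t \<longleftrightarrow> u \<in> lattice_basis d e t"
proof -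
  let ?L = "lattice_basis d e t"
  have L: "(n, 0) \<in> ?L" "(0, n) \<in> ?L"
    using assms multiples_in_lattice_basis[of d n e t] by (auto simp: lattice_indices_def)
  have translate: "(x, y) + (n * a, n * b) \<in> ?L" if xy: "(x, y) \<in> ?L" for x y a b
  proof -
    obtain k l where 1: "x = d * k" "y = t * k + e * l"
      using xy by (auto simp: lattice_basis_def)
    obtain k1 l1 where 2: "n = d * k1" "0 = t * k1 + e * l1"
      using L(1) by (auto simp: lattice_basis_def)
    obtain k2 l2 where 3: "0 = d * k2" "n = t * k2 + e * l2"
      using L(2) by (auto simp: lattice_basis_def)
    have x: "x + n * a = d * (k + a * k1 + b * k2)"
      using 1 2 3 by (simp add: algebra_simps)
    have "t * (k + a * k1 + b * k2) + e * (l + a * l1 + b * l2)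
        = (t * k + e * l) + a * (t * k1 + e * l1) + b * (t * k2 + e * l2)"
      by (simp only: algebra_simps)
    then have y: "y + n * b = t * (k + a * k1 + b * k2) + e * (l + a * l1 + b * l2)"
      unfolding 1(2)[symmetric] 2(2)[symmetric] 3(2)[symmetric] by (simp only: algebra_simps)
    show ?thesis unfolding lattice_basis_def using x y by auto
  qed
  obtain x y where u: "u = (x, y)" by (cases u)
  show ?thesis
    using translate[of x y "- (x div n)" "- (y div n)"] translate[of "x mod n" "y mod n" "x div n" "y div n"]
    unfolding u reduce_mod_def by (auto simp: minus_mult_div_eq_mod)
qed

text \<open>
  The correspondence between subgroups of the quotient \<open>(\<int> \<times> \<int>) / (n\<int> \<times> n\<int>)\<close> and lattices
  containing \<open>n\<int> \<times> n\<int>\<close>, composed with the normal form. The inverse sends a subgroup to its full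
  preimage under reduction.
\<close>
lemma lattice_residues_bij_subgroups:
  assumes "n > 1"
  shows "bij_betw (lattice_residues n) (lattice_indices n)
    {H. subgroup H (add_monoid (residue_square n))}"
proof (rule bij_betwI')
  fix i j assume ij: "i \<in> lattice_indices n" "j \<in> lattice_indices n"
  obtain d e t where i: "i = (d, e, t)" by (cases i)
  obtain d' e' t' where j: "j = (d', e', t')" by (cases j)
  show "lattice_residues n i = lattice_residues n j \<longleftrightarrow> i = j"
  proof
    assume eq: "lattice_residues n i = lattice_residues n j"
    have "u \<in> lattice_basis d e t \<longleftrightarrow> u \<in> lattice_basis d' e' t'" for u
    proof -
      have "reduce_mod n u \<in> lattice_residues n i \<longleftrightarrow> reduce_mod n u \<in> lattice_residues n j"
        using eq by simp
      then show ?thesis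
        using ij assms
        by (simp add: i j lattice_residues_def reduce_mod_in_box lattice_basis_reduce_mod_iff)
    qed
    then have "lattice_basis d e t = lattice_basis d' e' t'" by blast
    then have "d = d' \<and> e = e' \<and> t = t'"
      by (rule lattice_basis_inject)
        (use ij in \<open>auto simp: i j lattice_indices_def pos_divisors_def shifts_def\<close>)
    then show "i = j" by (simp add: i j)
  qed simp
next
  fix i assume "i \<in> lattice_indices n"
  moreover obtain d e t where i: "i = (d, e, t)" by (cases i)
  ultimately have idx: "(d, e, t) \<in> lattice_indices n" by simp
  have "(d * 0, t * 0 + e * 0) \<in> lattice_basis d e t" unfolding lattice_basis_def by blast
  then have "(0, 0) \<in> lattice_basis d e t \<inter> residue_box n"
    using assms by (simp add: residue_box_def)
  moreover have "reduce_mod n (u - v) \<in> lattice_basis d e t \<inter> residue_box n"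
    if "u \<in> lattice_basis d e t" "v \<in> lattice_basis d e t" for u v
    using that diff_closed_lattice_basis[of d e t] assms
    by (simp add: lattice_basis_reduce_mod_iff[OF idx] reduce_mod_in_box diff_closed_def)
  ultimately show "lattice_residues n i \<in> {H. subgroup H (add_monoid (residue_square n))}"
    unfolding mem_Collect_eq residue_square_subgroup_iff[OF assms]
    by (auto simp: i lattice_residues_def)
next
  fix H assume "H \<in> {H. subgroup H (add_monoid (residue_square n))}"
  then have H: "H \<subseteq> residue_box n" "H \<noteq> {}" "\<And>u v. u \<in> H \<Longrightarrow> v \<in> H \<Longrightarrow> reduce_mod n (u - v) \<in> H"
    by (auto simp only: mem_Collect_eq residue_square_subgroup_iff[OF assms])
  \<comment> \<open>the preimage of \<open>H\<close> under reduction\<close>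
  define L where "L = {u. reduce_mod n u \<in> H}"
  from H(2) obtain w where "w \<in> H" by blast
  from H(3)[OF this this] have zero: "(0, 0) \<in> H" by (simp add: reduce_mod_def)
  have "diff_closed L"
    unfolding diff_closed_def L_def using H(3) by (fastforce simp: reduce_mod_diff dest: H(3))
  moreover have "(n, 0) \<in> L" "(0, n) \<in> L" using zero by (simp_all add: L_def reduce_mod_def)
  ultimately obtain d e t where det: "d \<in> pos_divisors n" "e \<in> pos_divisors n" "t \<in> shifts n d e"
    "L = lattice_basis d e t"
    using assms by (elim lattice_normal_form) auto
  have "H = L \<inter> residue_box n" using H(1) by (auto simp: L_def reduce_mod_box)
  then show "\<exists>i\<in>lattice_indices n. H = lattice_residues n i"
    using det by (intro bexI[of _ "(d, e, t)"]) (auto simp: lattice_residues_def lattice_indices_def)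
qed

text \<open>
  If the lattice is closed under multiplication by \<open>(1, 0)\<close>, then it contains \<open>(d, 0)\<close> along with
  \<open>(d, t)\<close>, and the bound \<open>t < e\<close> leaves only \<open>t = 0\<close>. Conversely, \<open>t = 0\<close> gives the product
  \<open>d\<int> \<times> e\<int>\<close> of two ideals.
\<close>
lemma lattice_residues_ideal_iff:
  assumes "n > 1" and idx: "(d, e, t) \<in> lattice_indices n"
  shows "ideal (lattice_residues n (d, e, t)) (residue_square n) \<longleftrightarrow> t = 0"
proof -
  have sub: "subgroup (lattice_residues n (d, e, t)) (add_monoid (residue_square n))"
    using lattice_residues_bij_subgroups[OF assms(1)] idx unfolding bij_betw_def by blast
  have idx': "d > 0" "e > 0" "0 \<le> t" "t < e" "d dvd n" "e dvd n"
    using idx by (auto simp: lattice_indices_def pos_divisors_def shifts_def)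
  show ?thesis
  proof
    assume "ideal (lattice_residues n (d, e, t)) (residue_square n)"
    then interpret ideal "lattice_residues n (d, e, t)" "residue_square n" .
    have "(d * 1, t * 1 + e * 0) \<in> lattice_basis d e t" unfolding lattice_basis_def by blast
    then have "reduce_mod n (d, t) \<in> lattice_residues n (d, e, t)"
      using assms by (simp add: lattice_residues_def lattice_basis_reduce_mod_iff reduce_mod_in_box)
    moreover have "(1, 0) \<in> carrier (residue_square n)"
      using assms by (simp add: residue_square_simps(1) residue_box_def)
    ultimately have "(1, 0) \<otimes>\<^bsub>residue_square n\<^esub> reduce_mod n (d, t) \<in> lattice_residues n (d, e, t)"
      by (rule I_l_closed)
    then have "reduce_mod n (d, 0) \<in> lattice_basis d e t"
      by (simp add: residue_square_simps(4) reduce_mod_def lattice_residues_def)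
    then have "(d, 0) \<in> lattice_basis d e t"
      by (simp only: lattice_basis_reduce_mod_iff[OF idx])
    then obtain k l where "d = d * k" "0 = t * k + e * l" by (auto simp: lattice_basis_def)
    then have "t = e * (- l)" using idx' by simp
    then have "e dvd t" by simp
    then show "t = 0" using idx' zdvd_not_zless[of t e] by force
  next
    assume t: "t = 0"
    have mem: "(x, y) \<in> lattice_basis d e 0 \<longleftrightarrow> d dvd x \<and> e dvd y" for x y
      by (auto simp: lattice_basis_def elim!: dvdE)
    have idx0: "(d, e, 0) \<in> lattice_indices n" using idx t by simp
    have cl: "reduce_mod n (fst u * fst v, snd u * snd v) \<in> lattice_residues n (d, e, 0)"
      if "u \<in> lattice_residues n (d, e, 0) \<or> v \<in> lattice_residues n (d, e, 0)" for u v
      using that assms(1) mem[of "fst u" "snd u"] mem[of "fst v" "snd v"]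
      by (auto simp: lattice_residues_def lattice_basis_reduce_mod_iff[OF idx0] reduce_mod_in_box mem)
    show "ideal (lattice_residues n (d, e, t)) (residue_square n)"
      by (rule idealI[OF residue_square_ring[OF assms(1)] sub])
        (use cl in \<open>auto simp only: t residue_square_simps(4)\<close>)
  qed
qed

section \<open>Counting\<close>

lemma finite_pos_divisors: "n > 0 \<Longrightarrow> finite (pos_divisors n)"
  by (rule finite_subset[of _ "{0..n}"]) (auto simp: pos_divisors_def zdvd_imp_le)

text \<open>
  With \<open>g = gcd (n / d) e\<close>, cancelling \<open>g\<close> turns the divisibility condition into \<open>(e / g) dvd t\<close>,
  and there are \<open>g\<close> multiples of \<open>e / g\<close> in \<open>{0..<e}\<close>.
\<close>
lemma card_shifts:
  assumes "d \<in> pos_divisors n" "e \<in> pos_divisors n" 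
  shows "card (shifts n d e) = nat (gcd (n div d) e)"
proof -
  let ?m = "n div d"
  define g where "g = gcd ?m e"
  have e: "e > 0" using assms by (simp add: pos_divisors_def)
  have g: "g > 0" using e by (simp add: g_def)
  obtain e' where e': "e = g * e'" unfolding g_def by (meson gcd_dvd2 dvdE)
  obtain m' where m': "?m = g * m'" unfolding g_def by (meson gcd_dvd1 dvdE)
  have cop: "coprime e' m'"
  proof -
    have "e' = e div g" "m' = ?m div g" using g by (simp add: e', simp add: m')
    then show ?thesis
      using div_gcd_coprime[of ?m e] e by (simp add: g_def coprime_commute)
  qed
  have e'pos: "e' > 0" using e e' g by (simp add: zero_less_mult_iff)
  have div: "e dvd ?m * t \<longleftrightarrow> e' dvd t" for t
    using g cop by (simp add: e' m' mult.assoc coprime_dvd_mult_right_iff)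
  have "shifts n d e = (\<lambda>s. e' * s) ` {0..<g}"
  proof (intro Set.set_eqI iffI)
    fix t assume "t \<in> shifts n d e"
    then have t: "0 \<le> t" "t < e" "e' dvd t" by (simp_all add: shifts_def div)
    then obtain s where s: "t = e' * s" by (auto elim: dvdE)
    have "0 \<le> s" "s < g"
      using t s e' e'pos by (simp_all add: zero_le_mult_iff mult.commute[of g])
    then show "t \<in> (\<lambda>s. e' * s) ` {0..<g}" using s by auto
  next
    fix t assume "t \<in> (\<lambda>s. e' * s) ` {0..<g}"
    then obtain s where s: "t = e' * s" "0 \<le> s" "s < g" by fastforce
    then have "0 \<le> t" "t < e" "e' dvd t"
      using e'pos by (simp_all add: e' mult.commute[of g])
    then show "t \<in> shifts n d e" by (simp add: shifts_def div)
  qed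
  moreover have "inj_on (\<lambda>s. e' * s) {0..<g}" using e'pos by (auto simp: inj_on_def)
  ultimately show ?thesis by (simp add: card_image g_def)
qed

theorem card_subgroups_residue_square:
  assumes "n > 1"
  shows "card {H. subgroup H (add_monoid (residue_square n))}
    = (\<Sum>d\<in>pos_divisors n. \<Sum>e\<in>pos_divisors n. nat (gcd d e))"
proof -
  have fin: "finite (pos_divisors n)" using assms by (intro finite_pos_divisors) auto
  have fin': "finite (shifts n d e)" for d e
    by (rule finite_subset[of _ "{0..e}"]) (auto simp: shifts_def)
  have "card {H. subgroup H (add_monoid (residue_square n))} = card (lattice_indices n)"
    using bij_betw_same_card[OF lattice_residues_bij_subgroups[OF assms]] by simp
  also have "\<dots> = (\<Sum>d\<in>pos_divisors n. \<Sum>e\<in>pos_divisors n. card (shifts n d e))"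
    unfolding lattice_indices_def using fin fin' by (simp add: card_SigmaI)
  also have "\<dots> = (\<Sum>d\<in>pos_divisors n. \<Sum>e\<in>pos_divisors n. nat (gcd (n div d) e))"
    by (intro sum.cong refl card_shifts)
  \<comment> \<open>the complementary divisor map is an involution\<close>
  also have "\<dots> = (\<Sum>d\<in>pos_divisors n. \<Sum>e\<in>pos_divisors n. nat (gcd d e))"
    by (rule sum.reindex_bij_witness[of _ "\<lambda>d. n div d" "\<lambda>d. n div d"])
      (use assms in \<open>auto simp: pos_divisors_def pos_imp_zdiv_pos_iff zdvd_imp_le
         div_div_eq_right elim!: dvdE\<close>)
  finally show ?thesis .
qed

theorem card_ideals_residue_square:
  assumes "n > 1"
  shows "card {I. ideal I (residue_square n)} = (card (pos_divisors n))\<^sup>2"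
proof -
  let ?D = "pos_divisors n"
  let ?f = "\<lambda>(d, e). lattice_residues n (d, e, 0)"
  note bij = lattice_residues_bij_subgroups[OF assms]
  have idx: "(d, e, 0) \<in> lattice_indices n" if "d \<in> ?D" "e \<in> ?D" for d e
    using that by (auto simp: lattice_indices_def shifts_def pos_divisors_def)
  have "bij_betw ?f (?D \<times> ?D) {I. ideal I (residue_square n)}"
  proof (rule bij_betw_imageI)
    have inj: "inj_on (lattice_residues n) (lattice_indices n)" using bij by (rule bij_betw_imp_inj_on)
    show "inj_on ?f (?D \<times> ?D)"
      by (rule inj_onI) (auto dest!: inj_onD[OF inj] intro: idx)
    show "?f ` (?D \<times> ?D) = {I. ideal I (residue_square n)}"
    proof (intro Set.set_eqI iffI)
      fix I assume "I \<in> ?f ` (?D \<times> ?D)"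
      then show "I \<in> {I. ideal I (residue_square n)}"
        using idx lattice_residues_ideal_iff[OF assms] by auto
    next
      fix I assume "I \<in> {I. ideal I (residue_square n)}"
      then have I: "ideal I (residue_square n)" by simp
      then have "subgroup I (add_monoid (residue_square n))"
        using ideal.axioms(1) additive_subgroup.a_subgroup by blast
      then have "I \<in> lattice_residues n ` lattice_indices n"
        using bij by (simp only: bij_betw_def mem_Collect_eq)
      then obtain d e t where det: "(d, e, t) \<in> lattice_indices n" "I = lattice_residues n (d, e, t)"
        by auto
      then have "t = 0" using lattice_residues_ideal_iff[OF assms] I by blast
      with det show "I \<in> ?f ` (?D \<times> ?D)" by (auto simp: lattice_indices_def)
    qed
  qed
  from bij_betw_same_card[OF this] show ?thesis
    by (simp add: card_cartesian_product power2_eq_square)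
qed

lemma bij_betw_pos_divisors_prime_power:
  fixes p :: nat
  assumes "prime p"
  shows "bij_betw (\<lambda>i. int p ^ i) {..r} (pos_divisors (int (p ^ r)))"
proof (rule bij_betw_imageI)
  have p: "p > 1" using assms by (rule prime_gt_1_nat)
  then show "inj_on (\<lambda>i. int p ^ i) {..r}" by (auto simp: inj_on_def power_inject_exp)
  show "(\<lambda>i. int p ^ i) ` {..r} = pos_divisors (int (p ^ r))"
  proof (intro Set.set_eqI iffI)
    fix x assume "x \<in> (\<lambda>i. int p ^ i) ` {..r}"
    then show "x \<in> pos_divisors (int (p ^ r))"
      using p by (auto simp: pos_divisors_def le_imp_power_dvd)
  next
    fix x assume "x \<in> pos_divisors (int (p ^ r))"
    then obtain m where m: "x = int m" "m dvd p ^ r"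
      unfolding pos_divisors_def by (metis (lifting) mem_Collect_eq int_dvd_int_iff zero_less_imp_eq_int)
    then obtain i where "i \<le> r" "m = p ^ i" using assms by (auto simp: divides_primepow_nat)
    then show "x \<in> (\<lambda>i. int p ^ i) ` {..r}" using m by auto
  qed
qed

lemma nat_gcd_prime_power: "nat (gcd (int p ^ i) (int p ^ j)) = p ^ min i j"
proof -
  have "gcd (p ^ i) (p ^ j) = p ^ min i j"
    by (cases "i \<le> j") (simp_all add: gcd_proj1_if_dvd gcd_proj2_if_dvd le_imp_power_dvd min_def)
  then show ?thesis by (metis gcd_int_int_eq nat_int of_nat_power)
qed

text \<open>
  Raising \<open>r\<close> by one adds a corner \<open>x\<^sup>r\<^sup>+\<^sup>1\<close> and two copies of the geometric sum
  \<open>x\<^sup>0 + \<dots> + x\<^sup>r\<close>; one factor \<open>x - 1\<close> telescopes each of them to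
  \<open>x\<^sup>r\<^sup>+\<^sup>1 - 1\<close>.
\<close>
lemma sum_power_min:
  fixes x :: real
  shows "(x - 1)\<^sup>2 * (\<Sum>i\<le>r. \<Sum>j\<le>r. x ^ min i j)
    = x ^ (r + 1) * (x + 1) - 2 * real r * (x - 1) - 3 * x + 1"
proof (induction r)
  case 0
  show ?case by (simp add: power2_eq_square algebra_simps)
next
  case (Suc r)
  have geom: "(x - 1) * (\<Sum>i\<le>r. x ^ i) = x ^ (r + 1) - 1"
    using power_diff_1_eq[of x "Suc r", unfolded lessThan_Suc_atMost] by simp
  have "(\<Sum>i\<le>Suc r. \<Sum>j\<le>Suc r. x ^ min i j)
      = (\<Sum>i\<le>r. \<Sum>j\<le>r. x ^ min i j) + 2 * (\<Sum>i\<le>r. x ^ i) + x ^ (r + 1)"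
    by (simp add: sum.distrib min_def)
  then have "(x - 1)\<^sup>2 * (\<Sum>i\<le>Suc r. \<Sum>j\<le>Suc r. x ^ min i j)
      = (x - 1)\<^sup>2 * (\<Sum>i\<le>r. \<Sum>j\<le>r. x ^ min i j)
        + 2 * (x - 1) * ((x - 1) * (\<Sum>i\<le>r. x ^ i)) + (x - 1)\<^sup>2 * x ^ (r + 1)"
    by (simp only: algebra_simps power2_eq_square)
  then show ?case
    unfolding Suc.IH geom by (simp add: power2_eq_square algebra_simps)
qed

lemma ideal_probability_residue_square_prime_power:
  fixes p r :: nat
  assumes "prime p" and "r > 0"
  shows "ideal_probability (residue_square (int (p ^ r)))
    = (real r + 1)\<^sup>2 / (\<Sum>i\<le>r. \<Sum>j\<le>r. real p ^ min i j)"
proof -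
  have n: "int (p ^ r) > 1" using assms prime_gt_1_nat[of p] by (metis of_nat_1 of_nat_less_iff one_less_power)
  note bij = bij_betw_pos_divisors_prime_power[OF assms(1), of r]
  have "card (pos_divisors (int (p ^ r))) = r + 1"
    using bij_betw_same_card[OF bij] by simp
  then have num: "card {I. ideal I (residue_square (int (p ^ r)))} = (r + 1)\<^sup>2"
    using card_ideals_residue_square[OF n] by simp
  have "card {H. subgroup H (add_monoid (residue_square (int (p ^ r))))}
      = (\<Sum>i\<le>r. \<Sum>j\<le>r. nat (gcd (int p ^ i) (int p ^ j)))"
    unfolding card_subgroups_residue_square[OF n] sum.reindex_bij_betw[OF bij, symmetric] ..
  also have "\<dots> = (\<Sum>i\<le>r. \<Sum>j\<le>r. p ^ min i j)" by (simp only: nat_gcd_prime_power)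
  finally have den: "card {H. subgroup H (add_monoid (residue_square (int (p ^ r))))}
      = (\<Sum>i\<le>r. \<Sum>j\<le>r. p ^ min i j)" .
  show ?thesis unfolding ideal_probability_def num den by (simp add: add.commute)
qed

theorem corollary5p5:
  fixes p r :: nat
  assumes "prime p" and "r > 0"
  shows "ideal_probability (RDirProd (residue_ring (int (p ^ r))) (residue_ring (int (p ^ r))))
           = (real r + 1)\<^sup>2 * (real p - 1)\<^sup>2 /
             (real p ^ (r + 1) * (real p + 1) - 2 * real r * (real p - 1) - 3 * real p + 1)
         \<and>
         ideal_probability (RDirProd (residue_ring (int p)) (residue_ring (int p)))
           = 4 / (real p + 3)"
proof
  have "(real p - 1)\<^sup>2 \<noteq> 0" using prime_gt_1_nat[OF assms(1)] by simp
  then show "ideal_probability (residue_square (int (p ^ r)))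
           = (real r + 1)\<^sup>2 * (real p - 1)\<^sup>2 /
             (real p ^ (r + 1) * (real p + 1) - 2 * real r * (real p - 1) - 3 * real p + 1)"
    unfolding ideal_probability_residue_square_prime_power[OF assms] sum_power_min[symmetric]
    by (simp add: mult.commute)
  show "ideal_probability (residue_square (int p)) = 4 / (real p + 3)"
    using ideal_probability_residue_square_prime_power[OF assms(1), of 1]
    by (simp add: min_def add.commute)
qed

end
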